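(* Let $\Lambda$ be an Eulerian lattice of rank $n$ and $\nu\in\Lambda$ with $\hat0<\nu<\hat1$. Let $\Lambda_\nu=\{\sigma\in\Lambda:\sigma\vee\nu<\hat1\}$ and $\Lambda'_\nu=\Lambda_\nu\cup\{*\}$, where $*$ is a new element of rank $n$ with $\sigma<*$ exactly for those $\sigma\in\Lambda_\nu$ with $\nu\not\le\sigma$. Then \[\Psi_{\Lambda'_\nu}=\sum_{\nu\le\pi<\hat1}\Psi_{[\hat0,\pi)}\cdot\alpha_{\rho(\pi,\hat1)}.\]
   Context: Conventions: all posets are finite and graded, have a minimum $\hat0$ of rank $0$, and need not have a maximum. $\rho$ is rank, $\rho(x,y)=\rho(y)-\rho(x)$. For $\Lambda$ of rank $n$, $\hat1$ is a formally adjoined maximum of rank $n+1$; $\Lambda$ is a lattice if $\Lambda\cup\{\hat1\}$ is a lattice, and $\vee$ is the join in $\Lambda\cup\{\hat1\}$. $\Lambda$ is Eulerian if for all $\tau<\pi$ in $\Lambda\cup\{\hat1\}$, $\sum_{\tau\le\sigma\le\pi}(-1)^{\rho(\tau,\sigma)}=0$. $\mathbf{a}\mathbf{b}$-index: for a chain $x=\{\hat0=\sigma_0<\cdots<\sigma_k\}$ in a poset $P$ with top $\hat1$, $\mathrm{wt}(x)=(\mathbf a-\mathbf b)^{\rho(\sigma_0,\sigma_1)-1}\mathbf b\cdots\mathbf b(\mathbf a-\mathbf b)^{\rho(\sigma_k,\hat1)-1}$ (noncommuting variables) and $\Psi_P=\sum_x\mathrm{wt}(x)$. For $\Lambda'_\nu$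 the top has rank $n+1$ (and $\rho( * )=n$); for $[\hat0,\pi)=\{\sigma:\sigma<\pi\}$ the top is $\pi$. Here $\mathbf c=\mathbf a+\mathbf b$, $\mathbf d=\mathbf a\mathbf b+\mathbf b\mathbf a$, and $\alpha_0=-1$, $\alpha_{2k}=-\tfrac12[(\mathbf c^2-2\mathbf d)^k+\mathbf c(\mathbf c^2-2\mathbf d)^{k-1}\mathbf c]$ for $k\ge1$, $\alpha_{2k+1}=\tfrac12[(\mathbf c^2-2\mathbf d)^k\mathbf c+\mathbf c(\mathbf c^2-2\mathbf d)^k]$ for $k\ge0$. *)

theory Defs
  imports Complex_Main "HOL-Algebra.Lattice" "HOL-Library.Poly_Mapping"
begin

text \<open>The free associative algebra \<open>\<rat>\<langle>a,b\<rangle>\<close> is the monoid algebra of the free monoid on two letters.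
  The free monoid is written additively (as a \<open>monoid_add\<close>, hence not assumed commutative) so that the
  convolution product of \<^theory>\<open>HOL-Library.Poly_Mapping\<close> applies.\<close>

datatype letter = LA | LB

datatype ab_word = Word "letter list"

instantiation ab_word :: monoid_add
begin

definition zero_ab_word :: ab_word where
  "zero_ab_word = Word []"

fun plus_ab_word :: "ab_word \<Rightarrow> ab_word \<Rightarrow> ab_word" where
  "plus_ab_word (Word u) (Word v) = Word (u @ v)"

instance
proof
  fix u v w :: ab_word
  show "u + v + w = u + (v + w)"
    by (cases u; cases v; cases w) simp
  show "0 + u = u" "u + 0 = u"
    by (cases u; simp add: zero_ab_word_def)+
qed

end

type_synonym ab_poly = "ab_word \<Rightarrow>\<^sub>0 rat"

definition ab_const :: "rat \<Rightarrow> ab_poly" where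
  "ab_const r = Poly_Mapping.single 0 r"

definition ab_a :: ab_poly where
  "ab_a = Poly_Mapping.single (Word [LA]) 1"

definition ab_b :: ab_poly where
  "ab_b = Poly_Mapping.single (Word [LB]) 1"

definition ab_c :: ab_poly where
  "ab_c = ab_a + ab_b"

definition ab_d :: ab_poly where
  "ab_d = ab_a * ab_b + ab_b * ab_a"

definition alpha :: "nat \<Rightarrow> ab_poly" where
  "alpha m =
    (let k = m div 2; e = ab_c ^ 2 - 2 * ab_d in
     if m = 0 then - 1
     else if even m then - (ab_const (1/2) * (e ^ k + ab_c * e ^ (k - 1) * ab_c))
     else ab_const (1/2) * (e ^ k * ab_c + ab_c * e ^ k))"

definition covered_by :: "'a gorder \<Rightarrow> 'a \<Rightarrow> 'a \<Rightarrow> bool" where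
  "covered_by L x y \<longleftrightarrow> x \<sqsubset>\<^bsub>L\<^esub> y \<and> \<not> (\<exists>z\<in>carrier L. x \<sqsubset>\<^bsub>L\<^esub> z \<and> z \<sqsubset>\<^bsub>L\<^esub> y)"

definition graded_poset :: "'a gorder \<Rightarrow> ('a \<Rightarrow> nat) \<Rightarrow> bool" where
  "graded_poset L \<rho> \<longleftrightarrow>
     partial_order L \<and> finite (carrier L) \<and> (\<exists>z. least L z (carrier L)) \<and>
     \<rho> \<bottom>\<^bsub>L\<^esub> = 0 \<and>
     (\<forall>x\<in>carrier L. \<forall>y\<in>carrier L. covered_by L x y \<longrightarrow> \<rho> y = \<rho> x + 1)"

definition poset_rank :: "'a gorder \<Rightarrow> ('a \<Rightarrow> nat) \<Rightarrow> nat" where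
  "poset_rank L \<rho> = Max (\<rho> ` carrier L)"

text \<open>The poset with a formally adjoined maximum, which is represented by \<open>None\<close>.\<close>

definition add_top :: "'a gorder \<Rightarrow> 'a option gorder" where
  "add_top L =
     \<lparr>carrier = insert None (Some ` carrier L),
      eq = (=),
      le = (\<lambda>x y. case (x, y) of
                    (_, None) \<Rightarrow> True
                  | (None, Some _) \<Rightarrow> False
                  | (Some \<sigma>, Some \<tau>) \<Rightarrow> \<sigma> \<sqsubseteq>\<^bsub>L\<^esub> \<tau>)\<rparr>"

definition add_top_rank :: "'a gorder \<Rightarrow> ('a \<Rightarrow> nat) \<Rightarrow> 'a option \<Rightarrow> nat" where
  "add_top_rank L \<rho> = case_option (poset_rank L \<rho> + 1) \<rho>"

definition eulerian :: "'a gorder \<Rightarrow> ('a \<Rightarrow> nat) \<Rightarrow> bool" where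
  "eulerian L \<rho> \<longleftrightarrow>
     (\<forall>\<tau>\<in>carrier (add_top L). \<forall>\<pi>\<in>carrier (add_top L). \<tau> \<sqsubset>\<^bsub>add_top L\<^esub> \<pi> \<longrightarrow>
        (\<Sum>\<sigma>\<in>{\<sigma>\<in>carrier (add_top L). \<tau> \<sqsubseteq>\<^bsub>add_top L\<^esub> \<sigma> \<and> \<sigma> \<sqsubseteq>\<^bsub>add_top L\<^esub> \<pi>}.
           (- 1 :: int) ^ (add_top_rank L \<rho> \<sigma> - add_top_rank L \<rho> \<tau>)) = 0)"

definition chains :: "'a gorder \<Rightarrow> 'a list set" where
  "chains P = {xs. xs \<noteq> [] \<and> set xs \<subseteq> carrier P \<and> hd xs = \<bottom>\<^bsub>P\<^esub> \<and> sorted_wrt (lless P) xs}"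

text \<open>\<open>N\<close> is the rank of the top element. The top itself is not an element of \<open>P\<close> and never belongs to a
  chain. The value on the empty list is irrelevant.\<close>

fun chain_wt :: "('a \<Rightarrow> nat) \<Rightarrow> nat \<Rightarrow> 'a list \<Rightarrow> ab_poly" where
  "chain_wt \<rho> N [] = 0"
| "chain_wt \<rho> N [x] = (ab_a - ab_b) ^ (N - \<rho> x - 1)"
| "chain_wt \<rho> N (x # y # xs) = (ab_a - ab_b) ^ (\<rho> y - \<rho> x - 1) * ab_b * chain_wt \<rho> N (y # xs)"

definition ab_index :: "'a gorder \<Rightarrow> ('a \<Rightarrow> nat) \<Rightarrow> nat \<Rightarrow> ab_poly" where
  "ab_index P \<rho> N = (\<Sum>xs\<in>chains P. chain_wt \<rho> N xs)"

definition below :: "'a gorder \<Rightarrow> 'a \<Rightarrow> 'a gorder" where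
  "below L \<pi> = L\<lparr>carrier := {\<sigma>\<in>carrier L. \<sigma> \<sqsubset>\<^bsub>L\<^esub> \<pi>}\<rparr>"

definition join_below_top :: "'a gorder \<Rightarrow> 'a \<Rightarrow> 'a set" where
  "join_below_top L \<nu> =
     {\<sigma>\<in>carrier L. (Some \<sigma> \<squnion>\<^bsub>add_top L\<^esub> Some \<nu>) \<sqsubset>\<^bsub>add_top L\<^esub> None}"

text \<open>The poset \<open>\<Lambda>'\<^sub>\<nu>\<close>. Here \<open>None\<close> represents the new element \<open>*\<close>, not a maximum.\<close>

definition add_star :: "'a gorder \<Rightarrow> 'a \<Rightarrow> 'a option gorder" where
  "add_star L \<nu> =
     \<lparr>carrier = insert None (Some ` join_below_top L \<nu>),
      eq = (=),
      le = (\<lambda>x y. case (x, y) of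
                    (None, None) \<Rightarrow> True
                  | (None, Some _) \<Rightarrow> False
                  | (Some \<sigma>, None) \<Rightarrow> \<not> \<nu> \<sqsubseteq>\<^bsub>L\<^esub> \<sigma>
                  | (Some \<sigma>, Some \<tau>) \<Rightarrow> \<sigma> \<sqsubseteq>\<^bsub>L\<^esub> \<tau>)\<rparr>"

definition add_star_rank :: "'a gorder \<Rightarrow> ('a \<Rightarrow> nat) \<Rightarrow> 'a option \<Rightarrow> nat" where
  "add_star_rank L \<rho> = case_option (poset_rank L \<rho>) \<rho>"

end

theory Submission
  imports Defs
begin

text \<open>
  Put \<open>z = a - b\<close>, so that \<open>c = z + 2b\<close> and \<open>c\<^sup>2 - 2d = z\<^sup>2\<close>, and let \<open>F \<sigma>\<close> be the sum, over the chains
  from the minimum to \<open>\<sigma>\<close>, of the products of the factors \<open>z\<^bsup>r-1\<^esup> b\<close> over the steps of the chain. Then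
  \<open>\<Psi> b = F \<pi>\<close> for the index \<open>\<Psi>\<close> of the interval below \<open>\<pi>\<close>. Expanding \<open>\<alpha>\<close> in \<open>z\<close> and \<open>b\<close> gives, with
  \<open>G \<sigma> = F \<sigma> (z\<^bsup>n-\<rho>(\<sigma>)\<^esup> + z\<^bsup>n-\<rho>(\<sigma>)-1\<^esup> b)\<close>,
  \<open>\<Psi> \<alpha> = (-1)\<^bsup>n-\<rho>(\<pi>)\<^esup> (\<Sum>\<sigma>\<le>\<pi>. G \<sigma>) - F \<pi> z\<^bsup>n-\<rho>(\<pi>)-1\<^esup> b\<close>.
  Summing over \<open>\<pi> \<ge> \<nu>\<close> and exchanging the sums, the coefficient of \<open>G \<sigma>\<close> is the sum of
  \<open>(-1)\<^bsup>n-\<rho>(\<pi>)\<^esup>\<close> over all proper \<open>\<pi> \<ge> \<sigma> \<squnion> \<nu>\<close>; by the Eulerian relation it is 1 if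
  \<open>\<sigma> \<squnion> \<nu>\<close> is proper and 0 otherwise. The subtracted terms remove exactly those \<open>\<sigma> \<ge> \<nu>\<close> that are not
  below the new element.
\<close>

section \<open>Chain weights without the factor towards the top\<close>

fun chain_prefix_wt :: "('a \<Rightarrow> nat) \<Rightarrow> 'a list \<Rightarrow> ab_poly" where
  "chain_prefix_wt \<rho> (x # y # xs) = (ab_a - ab_b) ^ (\<rho> y - \<rho> x - 1) * ab_b * chain_prefix_wt \<rho> (y # xs)"
| "chain_prefix_wt \<rho> _ = 1"

text \<open>This is the F of the outline. It does not involve the rank of a top element, so it can
  be compared between different posets.\<close>

definition chain_sum :: "'a gorder \<Rightarrow> ('a \<Rightarrow> nat) \<Rightarrow> 'a \<Rightarrow> ab_poly" where
  "chain_sum P \<rho> \<sigma> = (\<Sum>xs\<in>{xs\<in>chains P. last xs = \<sigma>}. chain_prefix_wt \<rho> xs)"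

lemma chain_wt_eq_prefix_wt:
  "xs \<noteq> [] \<Longrightarrow> chain_wt \<rho> N xs = chain_prefix_wt \<rho> xs * (ab_a - ab_b) ^ (N - \<rho> (last xs) - 1)"
  by (induction \<rho> N xs rule: chain_wt.induct) (auto simp: mult.assoc)

lemma chain_prefix_wt_snoc:
  "xs \<noteq> [] \<Longrightarrow> chain_prefix_wt \<rho> (xs @ [y]) =
     chain_prefix_wt \<rho> xs * (ab_a - ab_b) ^ (\<rho> y - \<rho> (last xs) - 1) * ab_b"
  by (induction \<rho> xs rule: chain_prefix_wt.induct) (auto simp: mult.assoc)

lemma chain_prefix_wt_map:
  "(\<And>x. x \<in> set xs \<Longrightarrow> \<rho>' (f x) = \<rho> x) \<Longrightarrow> chain_prefix_wt \<rho>' (map f xs) = chain_prefix_wt \<rho> xs"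
  by (induction \<rho> xs rule: chain_prefix_wt.induct) auto

lemma sorted_wrt_last:
  "sorted_wrt R xs \<Longrightarrow> x \<in> set xs \<Longrightarrow> x \<noteq> last xs \<Longrightarrow> R x (last xs)"
  by (induction xs) auto

locale finite_partial_order = partial_order L for L :: "'a gorder" (structure) +
  assumes finite_carrier: "finite (carrier L)"
begin

lemma lless_iff: "x \<sqsubset> y \<longleftrightarrow> x \<sqsubseteq> y \<and> x \<noteq> y"
  by (simp add: lless_def eq_is_equal)

lemma bottom_eqI:
  assumes "least L z (carrier L)"
  shows "\<bottom> = z"
  unfolding bottom_def using assms by (blast intro: some_equality least_unique)

text \<open>A sum over an infinite set is 0 by convention, so regrouping sums over chains needs
  finiteness. It holds because strictly increasing lists have distinct entries.\<close>

lemma finite_chains: "finite (chains L)"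
proof (rule finite_subset)
  have "distinct xs" if "sorted_wrt (lless L) xs" for xs
    using that by (induction xs) (auto simp: lless_iff)
  then show "chains L \<subseteq> {xs. set xs \<subseteq> carrier L \<and> distinct xs}"
    by (auto simp: chains_def)
  show "finite {xs. set xs \<subseteq> carrier L \<and> distinct xs}"
    using finite_carrier by (rule finite_subset_distinct)
qed

lemma sum_chains_by_last:
  assumes "A \<subseteq> carrier L"
  shows "(\<Sum>\<sigma>\<in>A. \<Sum>xs\<in>{xs\<in>chains L. last xs = \<sigma>}. g xs) = (\<Sum>xs\<in>{xs\<in>chains L. last xs \<in> A}. g xs)"
proof -
  have "(\<Sum>xs\<in>{xs\<in>chains L. last xs \<in> A}. g xs) =
      (\<Sum>\<sigma>\<in>A. \<Sum>xs\<in>{xs\<in>{xs\<in>chains L. last xs \<in> A}. last xs = \<sigma>}. g xs)"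
    by (rule sum.group[symmetric]) (use assms finite_chains finite_carrier in \<open>auto intro: finite_subset\<close>)
  also have "\<dots> = (\<Sum>\<sigma>\<in>A. \<Sum>xs\<in>{xs\<in>chains L. last xs = \<sigma>}. g xs)"
    by (intro sum.cong) auto
  finally show ?thesis by simp
qed

text \<open>Grouping chains by their last element isolates the only factor in which \<open>N\<close>
  occurs.\<close>

lemma ab_index_eq_chain_sum:
  "ab_index L \<rho> N = (\<Sum>\<sigma>\<in>carrier L. chain_sum L \<rho> \<sigma> * (ab_a - ab_b) ^ (N - \<rho> \<sigma> - 1))"
proof -
  have "(\<Sum>\<sigma>\<in>carrier L. chain_sum L \<rho> \<sigma> * (ab_a - ab_b) ^ (N - \<rho> \<sigma> - 1)) =
      (\<Sum>\<sigma>\<in>carrier L. \<Sum>xs\<in>{xs\<in>chains L. last xs = \<sigma>}. chain_wt \<rho> N xs)"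
    unfolding chain_sum_def sum_distrib_right
    by (intro sum.cong) (auto simp: chain_wt_eq_prefix_wt chains_def)
  also have "\<dots> = (\<Sum>xs\<in>{xs\<in>chains L. last xs \<in> carrier L}. chain_wt \<rho> N xs)"
    by (intro sum_chains_by_last) auto
  also have "{xs\<in>chains L. last xs \<in> carrier L} = chains L"
    by (auto simp: chains_def)
  finally show ?thesis by (simp add: ab_index_def)
qed

text \<open>Deleting the last entry of a chain ending in \<open>y\<close> leaves a chain ending
  strictly below \<open>y\<close>; the deleted step accounts for the power and for the final
  \<open>ab_b\<close>.\<close>

lemma chain_sum_rec:
  assumes y: "y \<in> carrier L" "y \<noteq> \<bottom>"
  shows "chain_sum L \<rho> y =
    (\<Sum>\<sigma>\<in>{\<sigma>\<in>carrier L. \<sigma> \<sqsubset> y}. chain_sum L \<rho> \<sigma> * (ab_a - ab_b) ^ (\<rho> y - \<rho> \<sigma> - 1)) * ab_b"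
proof -
  let ?A = "{\<sigma>\<in>carrier L. \<sigma> \<sqsubset> y}"
  have "bij_betw (\<lambda>xs. xs @ [y]) {xs\<in>chains L. last xs \<in> ?A} {xs\<in>chains L. last xs = y}"
  proof (rule bij_betwI[where g = butlast])
    show "(\<lambda>xs. xs @ [y]) \<in> {xs\<in>chains L. last xs \<in> ?A} \<rightarrow> {xs\<in>chains L. last xs = y}"
    proof (rule Pi_I)
      fix xs assume xs: "xs \<in> {xs\<in>chains L. last xs \<in> ?A}"
      \<comment> \<open>Only the last entry is assumed to lie below \<open>y\<close>; the earlier
        ones follow by transitivity.\<close>
      have "x \<sqsubset> y" if x: "x \<in> set xs" for x
      proof (cases "x = last xs")
        case False
        with xs x have "x \<sqsubset> last xs" by (auto simp: chains_def intro: sorted_wrt_last)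
        with xs x y show ?thesis by (auto simp: chains_def intro: lless_trans)
      qed (use xs in auto)
      with xs y show "xs @ [y] \<in> {xs\<in>chains L. last xs = y}"
        by (auto simp: chains_def sorted_wrt_append)
    qed
    show "butlast \<in> {xs\<in>chains L. last xs = y} \<rightarrow> {xs\<in>chains L. last xs \<in> ?A}"
    proof (rule Pi_I)
      fix xs assume xs: "xs \<in> {xs\<in>chains L. last xs = y}"
      then obtain zs where zs: "xs = zs @ [y]"
        by (metis (mono_tags, lifting) append_butlast_last_id chains_def mem_Collect_eq)
      \<comment> \<open>The list \<open>[y]\<close> is not a chain, because chains start at the
        minimum and \<open>y\<close> is not the minimum.\<close>
      with xs y(2) have "zs \<noteq> []" by (auto simp: chains_def)
      with xs zs show "butlast xs \<in> {xs\<in>chains L. last xs \<in> ?A}"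
        by (auto simp: chains_def sorted_wrt_append)
    qed
  qed (auto simp: chains_def intro: append_butlast_last_id)
  then have "chain_sum L \<rho> y = (\<Sum>xs\<in>{xs\<in>chains L. last xs \<in> ?A}. chain_prefix_wt \<rho> (xs @ [y]))"
    unfolding chain_sum_def by (rule sum.reindex_bij_betw[symmetric])
  also have "\<dots> = (\<Sum>\<sigma>\<in>?A. \<Sum>xs\<in>{xs\<in>chains L. last xs = \<sigma>}. chain_prefix_wt \<rho> (xs @ [y]))"
    by (rule sum_chains_by_last[symmetric]) auto
  also have "\<dots> = (\<Sum>\<sigma>\<in>?A. chain_sum L \<rho> \<sigma> * (ab_a - ab_b) ^ (\<rho> y - \<rho> \<sigma> - 1)) * ab_b"
    unfolding chain_sum_def sum_distrib_right
    by (intro sum.cong HOL.refl) (auto simp: chain_prefix_wt_snoc chains_def)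
  finally show ?thesis .
qed

lemma restrict_finite_partial_order:
  assumes "D \<subseteq> carrier L"
  shows "finite_partial_order (L\<lparr>carrier := D\<rparr>)"
proof unfold_locales
  show "finite (carrier (L\<lparr>carrier := D\<rparr>))"
    using assms finite_carrier by (auto intro: finite_subset)
qed (use assms in \<open>auto simp: eq_is_equal intro: le_antisym le_trans\<close>)

end

text \<open>All entries of a chain ending in \<open>f \<sigma>\<close> lie weakly below it, and
  \<open>down\<close> places them in the image of \<open>f\<close>. Hence \<open>map f\<close>
  reaches every such chain even if \<open>f\<close> is not onto.\<close>

lemma chain_sum_embedding:
  assumes inj: "inj_on f (carrier P)"
    and carr: "f ` carrier P \<subseteq> carrier Q"
    and bot: "f \<bottom>\<^bsub>P\<^esub> = \<bottom>\<^bsub>Q\<^esub>" "\<bottom>\<^bsub>P\<^esub> \<in> carrier P"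
    and less: "\<And>x y. x \<in> carrier P \<Longrightarrow> y \<in> carrier P \<Longrightarrow> f x \<sqsubset>\<^bsub>Q\<^esub> f y \<longleftrightarrow> x \<sqsubset>\<^bsub>P\<^esub> y"
    and down: "\<And>x y. x \<in> carrier P \<Longrightarrow> y \<in> carrier Q \<Longrightarrow> y \<sqsubset>\<^bsub>Q\<^esub> f x \<Longrightarrow> y \<in> f ` carrier P"
    and rank: "\<And>x. x \<in> carrier P \<Longrightarrow> \<rho>' (f x) = \<rho> x"
    and \<sigma>: "\<sigma> \<in> carrier P"
  shows "chain_sum Q \<rho>' (f \<sigma>) = chain_sum P \<rho> \<sigma>"
proof -
  have sorted: "sorted_wrt (lless Q) (map f xs) \<longleftrightarrow> sorted_wrt (lless P) xs"
    if "set xs \<subseteq> carrier P" for xs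
    using that by (auto simp: sorted_wrt_map subset_iff less elim!: sorted_wrt_mono_rel[rotated])
  have map_chain: "map f xs \<in> {ys\<in>chains Q. last ys = f \<sigma>} \<longleftrightarrow> xs \<in> {xs\<in>chains P. last xs = \<sigma>}"
    if xs: "set xs \<subseteq> carrier P" for xs
  proof (cases "xs = []")
    case False
    then have "hd xs \<in> carrier P" "last xs \<in> carrier P" using xs by auto
    then have "f (hd xs) = \<bottom>\<^bsub>Q\<^esub> \<longleftrightarrow> hd xs = \<bottom>\<^bsub>P\<^esub>" "f (last xs) = f \<sigma> \<longleftrightarrow> last xs = \<sigma>"
      using bot \<sigma> inj by (auto dest: inj_onD simp flip: bot(1))
    then show ?thesis
      using False xs carr by (auto simp: chains_def sorted hd_map last_map)
  qed (auto simp: chains_def)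
  have "bij_betw (map f) {xs\<in>chains P. last xs = \<sigma>} {ys\<in>chains Q. last ys = f \<sigma>}"
  proof (rule bij_betw_imageI)
    show "inj_on (map f) {xs\<in>chains P. last xs = \<sigma>}"
      by (intro inj_on_mapI inj_on_subset[OF inj]) (auto simp: chains_def)
    show "map f ` {xs\<in>chains P. last xs = \<sigma>} = {ys\<in>chains Q. last ys = f \<sigma>}" (is "_ = ?B")
    proof
      show "map f ` {xs\<in>chains P. last xs = \<sigma>} \<subseteq> ?B"
      proof (rule image_subsetI)
        fix xs assume xs: "xs \<in> {xs\<in>chains P. last xs = \<sigma>}"
        then have "set xs \<subseteq> carrier P" by (auto simp: chains_def)
        with xs map_chain show "map f xs \<in> ?B" by blast
      qed
      show "?B \<subseteq> map f ` {xs\<in>chains P. last xs = \<sigma>}"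
      proof
        fix ys assume ys: "ys \<in> ?B"
        have "y \<in> f ` carrier P" if y: "y \<in> set ys" for y
        proof (cases "y = f \<sigma>")
          case False
          then have "y \<sqsubset>\<^bsub>Q\<^esub> f \<sigma>" using ys y by (auto simp: chains_def dest: sorted_wrt_last)
          then show ?thesis using ys y \<sigma> by (auto simp: chains_def intro: down)
        qed (use \<sigma> in auto)
        then have "ys \<in> lists (f ` carrier P)" by auto
        then obtain xs where "ys = map f xs" "set xs \<subseteq> carrier P"
          by (auto simp: lists_image)
        with ys map_chain show "ys \<in> map f ` {xs\<in>chains P. last xs = \<sigma>}" by blast
      qed
    qed
  qed
  then have "chain_sum Q \<rho>' (f \<sigma>) = (\<Sum>xs\<in>{xs\<in>chains P. last xs = \<sigma>}. chain_prefix_wt \<rho>' (map f xs))"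
    unfolding chain_sum_def by (rule sum.reindex_bij_betw[symmetric])
  also have "\<dots> = chain_sum P \<rho> \<sigma>"
    unfolding chain_sum_def
    by (intro sum.cong refl chain_prefix_wt_map) (auto simp: chains_def intro: rank)
  finally show ?thesis .
qed

section \<open>Expansion of \<alpha> in z and b\<close>

lemma ab_const_half_mult: "ab_const (1/2) * (x + x) = x"
proof -
  have "ab_const (1/2) * (x + x) = (ab_const (1/2) + ab_const (1/2)) * x"
    by (simp add: algebra_simps)
  also have "ab_const (1/2) + ab_const (1/2) = 1"
    by (simp add: ab_const_def flip: single_add)
  finally show ?thesis by simp
qed

text \<open>Both sides expand to a^2 - ab - ba + b^2. The powers inside \<open>alpha\<close> thus
  become even powers of z, which commute with the z in c = z + 2b.\<close>

lemma c_sq_minus_2d: "ab_c ^ 2 - 2 * ab_d = (ab_a - ab_b) ^ 2"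
  by (simp add: ab_c_def ab_d_def power2_eq_square algebra_simps mult_2)

lemma ab_c_eq: "ab_c = (ab_a - ab_b) + ab_b + ab_b"
  by (simp add: ab_c_def)

text \<open>Later k is n - \<rho>(\<pi>), so this is the \<alpha> of odd index. Substituting c = z +
  2b makes z^k c + c z^k twice the right-hand side, which absorbs the factor 1/2.\<close>

lemma alpha_Suc_even:
  assumes "even k"
  shows "alpha (Suc k) = (ab_a - ab_b) ^ Suc k + ab_b * (ab_a - ab_b) ^ k + (ab_a - ab_b) ^ k * ab_b"
proof -
  let ?z = "ab_a - ab_b"
  obtain j where j: "k = 2 * j" using assms by auto
  have "alpha (Suc k) = ab_const (1/2) * (?z ^ k * ab_c + ab_c * ?z ^ k)"
    by (simp add: alpha_def Let_def c_sq_minus_2d j flip: power_mult)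
  also have "?z ^ k * ab_c + ab_c * ?z ^ k =
      (?z ^ Suc k + ab_b * ?z ^ k + ?z ^ k * ab_b) + (?z ^ Suc k + ab_b * ?z ^ k + ?z ^ k * ab_b)"
    unfolding ab_c_eq distrib_left distrib_right power_Suc power_commutes[symmetric]
    by (simp only: ac_simps)
  finally show ?thesis by (simp only: ab_const_half_mult)
qed

text \<open>The two equal terms b z^(k-1) b are half of (2b) z^(k-1) (2b). They stay separate
  because one will belong to G \<pi> and the other is the term subtracted in the outline.\<close>

lemma alpha_Suc_odd:
  assumes "odd k"
  shows "alpha (Suc k) = - ((ab_a - ab_b) ^ Suc k + ab_b * (ab_a - ab_b) ^ k + (ab_a - ab_b) ^ k * ab_b
    + ab_b * (ab_a - ab_b) ^ (k - 1) * ab_b + ab_b * (ab_a - ab_b) ^ (k - 1) * ab_b)"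
proof -
  let ?z = "ab_a - ab_b"
  obtain j where j: "k = Suc (2 * j)" using assms by (auto elim: oddE)
  have "alpha (Suc k) = - (ab_const (1/2) * (?z ^ Suc k + ab_c * ?z ^ (k - 1) * ab_c))"
    by (simp add: alpha_def Let_def c_sq_minus_2d j flip: power_mult power_Suc)
  also have "?z ^ Suc k + ab_c * ?z ^ (k - 1) * ab_c =
      (?z ^ Suc k + ab_b * ?z ^ k + ?z ^ k * ab_b + ab_b * ?z ^ (k - 1) * ab_b + ab_b * ?z ^ (k - 1) * ab_b) +
      (?z ^ Suc k + ab_b * ?z ^ k + ?z ^ k * ab_b + ab_b * ?z ^ (k - 1) * ab_b + ab_b * ?z ^ (k - 1) * ab_b)"
  proof -
    \<comment> \<open>As k is odd it is positive, so the truncated k - 1 is exact.\<close>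
    have zk: "?z ^ k = ?z * ?z ^ (k - 1)" by (simp add: j)
    have comm: "?z ^ (k - 1) * ?z = ?z * ?z ^ (k - 1)" by (rule power_commutes)
    show ?thesis
      unfolding ab_c_eq distrib_left distrib_right power_Suc zk mult.assoc comm
      by (simp only: ac_simps)
  qed
  finally show ?thesis by (simp only: ab_const_half_mult)
qed

section \<open>Down-closed subposets and lower intervals\<close>

lemma lless_restrict [simp]: "x \<sqsubset>\<^bsub>L\<lparr>carrier := D\<rparr>\<^esub> y \<longleftrightarrow> x \<sqsubset>\<^bsub>L\<^esub> y"
  by (simp add: lless_def)

locale finite_partial_order_bottom = finite_partial_order +
  assumes bottom_exists: "\<exists>z. least L z (carrier L)"
begin

sublocale weak_partial_order_bottom L
  by unfold_locales (rule bottom_exists)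

lemma bottom_restrict:
  assumes "D \<subseteq> carrier L" "\<bottom> \<in> D"
  shows "\<bottom>\<^bsub>L\<lparr>carrier := D\<rparr>\<^esub> = \<bottom>"
  by (rule finite_partial_order.bottom_eqI[OF restrict_finite_partial_order])
    (use assms in \<open>auto simp: least_def\<close>)

text \<open>This is \<open>chain_sum_embedding\<close> for the identity: a chain ending in a
  down-closed set never leaves that set.\<close>

lemma chain_sum_restrict:
  assumes "D \<subseteq> carrier L" "\<bottom> \<in> D" "\<sigma> \<in> D"
    and "\<And>x y. x \<in> D \<Longrightarrow> y \<in> carrier L \<Longrightarrow> y \<sqsubset> x \<Longrightarrow> y \<in> D"
  shows "chain_sum (L\<lparr>carrier := D\<rparr>) \<rho> \<sigma> = chain_sum L \<rho> \<sigma>"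
  using chain_sum_embedding[of "\<lambda>x. x" "L\<lparr>carrier := D\<rparr>" L \<rho> \<rho> \<sigma>] assms
  by (auto simp: bottom_restrict)

lemma ab_index_below:
  assumes "\<pi> \<in> carrier L" "\<bottom> \<sqsubset> \<pi>"
  shows "ab_index (below L \<pi>) \<rho> N =
    (\<Sum>\<sigma>\<in>{\<sigma>\<in>carrier L. \<sigma> \<sqsubset> \<pi>}. chain_sum L \<rho> \<sigma> * (ab_a - ab_b) ^ (N - \<rho> \<sigma> - 1))"
proof -
  let ?D = "{\<sigma>\<in>carrier L. \<sigma> \<sqsubset> \<pi>}"
  have "y \<in> ?D" if "x \<in> ?D" "y \<in> carrier L" "y \<sqsubset> x" for x y
    using that assms by (auto intro: lless_trans)
  then have "chain_sum (L\<lparr>carrier := ?D\<rparr>) \<rho> \<sigma> = chain_sum L \<rho> \<sigma>" if "\<sigma> \<in> ?D" for \<sigma>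
    using that assms by (intro chain_sum_restrict) auto
  then show ?thesis
    unfolding below_def
    by (subst finite_partial_order.ab_index_eq_chain_sum[OF restrict_finite_partial_order]) auto
qed

text \<open>For \<open>N = \<rho> \<pi>\<close> the formula for the index of the interval and the
  recursion for the chain sum have the same summands, and only the recursion carries a final
  \<open>ab_b\<close>. A factor b directly after \<Psi> can thus be traded for F.\<close>

lemma chain_sum_eq_ab_index_below:
  assumes "\<pi> \<in> carrier L" "\<bottom> \<sqsubset> \<pi>"
  shows "chain_sum L \<rho> \<pi> = ab_index (below L \<pi>) \<rho> (\<rho> \<pi>) * ab_b"
  using assms chain_sum_rec[of \<pi> \<rho>] by (auto simp: ab_index_below lless_iff)

end

section \<open>Rank functions\<close>

lemma graded_poset_imp_order:
  "graded_poset L \<rho> \<Longrightarrow> finite_partial_order_bottom L"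
  by (simp add: graded_poset_def finite_partial_order_bottom_def finite_partial_order_def
      finite_partial_order_axioms_def finite_partial_order_bottom_axioms_def)

text \<open>The grading constrains covering pairs only. For any other pair an element in between
  splits the interval into two with fewer interior elements.\<close>

lemma graded_poset_rank_less:
  assumes gr: "graded_poset L \<rho>"
  shows "x \<in> carrier L \<Longrightarrow> y \<in> carrier L \<Longrightarrow> x \<sqsubset>\<^bsub>L\<^esub> y \<Longrightarrow> \<rho> x < \<rho> y"
proof (induction "card {z \<in> carrier L. x \<sqsubset>\<^bsub>L\<^esub> z \<and> z \<sqsubset>\<^bsub>L\<^esub> y}" arbitrary: x y rule: less_induct)
  case less
  interpret finite_partial_order_bottom L using gr by (rule graded_poset_imp_order)
  let ?I = "\<lambda>x y. {z \<in> carrier L. x \<sqsubset>\<^bsub>L\<^esub> z \<and> z \<sqsubset>\<^bsub>L\<^esub> y}"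
  show ?case
  proof (cases "covered_by L x y")
    case True
    with less.prems gr show ?thesis by (auto simp: graded_poset_def)
  next
    case False
    then obtain z where z: "z \<in> carrier L" "x \<sqsubset>\<^bsub>L\<^esub> z" "z \<sqsubset>\<^bsub>L\<^esub> y"
      using less.prems by (auto simp: covered_by_def)
    have "?I x z \<subseteq> ?I x y" "?I z y \<subseteq> ?I x y"
      using z less.prems by (auto intro: lless_trans)
    moreover have "z \<in> ?I x y" "z \<notin> ?I x z" "z \<notin> ?I z y"
      using z by (auto simp: lless_iff)
    ultimately have "?I x z \<subset> ?I x y" "?I z y \<subset> ?I x y"
      by blast+
    then have "card (?I x z) < card (?I x y)" "card (?I z y) < card (?I x y)"
      using finite_carrier by (auto intro!: psubset_card_mono)
    then have "\<rho> x < \<rho> z" "\<rho> z < \<rho> y"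
      using less.hyps less.prems z by blast+
    then show ?thesis by simp
  qed
qed

section \<open>The orders with an adjoined top and with the new element\<close>

lemma carrier_add_top [simp]: "carrier (add_top L) = insert None (Some ` carrier L)"
  and le_add_top [simp]: "x \<sqsubseteq>\<^bsub>add_top L\<^esub> None"
    "\<not> None \<sqsubseteq>\<^bsub>add_top L\<^esub> Some \<tau>"
    "Some \<sigma> \<sqsubseteq>\<^bsub>add_top L\<^esub> Some \<tau> \<longleftrightarrow> \<sigma> \<sqsubseteq>\<^bsub>L\<^esub> \<tau>"
  and lless_add_top_None [simp]: "x \<sqsubset>\<^bsub>add_top L\<^esub> None \<longleftrightarrow> x \<noteq> None"
  by (auto simp: add_top_def lless_def split: option.split)

lemma carrier_add_star [simp]: "carrier (add_star L \<nu>) = insert None (Some ` join_below_top L \<nu>)"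
  and le_add_star [simp]: "None \<sqsubseteq>\<^bsub>add_star L \<nu>\<^esub> None"
    "\<not> None \<sqsubseteq>\<^bsub>add_star L \<nu>\<^esub> Some \<tau>"
    "Some \<sigma> \<sqsubseteq>\<^bsub>add_star L \<nu>\<^esub> None \<longleftrightarrow> \<not> \<nu> \<sqsubseteq>\<^bsub>L\<^esub> \<sigma>"
    "Some \<sigma> \<sqsubseteq>\<^bsub>add_star L \<nu>\<^esub> Some \<tau> \<longleftrightarrow> \<sigma> \<sqsubseteq>\<^bsub>L\<^esub> \<tau>"
  and eq_add_star [simp]: "(.=\<^bsub>add_star L \<nu>\<^esub>) = (=)"
  by (auto simp: add_star_def)

section \<open>Joins with \<nu> and the Eulerian relation\<close>

locale graded_eulerian_lattice =
  fixes L :: "'a gorder" (structure) and \<rho> :: "'a \<Rightarrow> nat" and n :: nat and \<nu> :: 'a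
  assumes graded: "graded_poset L \<rho>"
    and n_def: "n = poset_rank L \<rho>"
    and lattice_top: "lattice (add_top L)"
    and eul: "eulerian L \<rho>"
    and nu_carrier: "\<nu> \<in> carrier L"
    and bottom_less_nu: "\<bottom> \<sqsubset> \<nu>"
begin

sublocale finite_partial_order_bottom L
  using graded by (rule graded_poset_imp_order)

abbreviation "z \<equiv> ab_a - ab_b"
abbreviation "F \<equiv> chain_sum L \<rho>"
abbreviation "\<Lambda>\<^sub>\<nu> \<equiv> join_below_top L \<nu>"

lemma rank_less: "x \<in> carrier L \<Longrightarrow> y \<in> carrier L \<Longrightarrow> x \<sqsubset> y \<Longrightarrow> \<rho> x < \<rho> y"
  using graded by (rule graded_poset_rank_less)

lemma rank_le: "x \<in> carrier L \<Longrightarrow> y \<in> carrier L \<Longrightarrow> x \<sqsubseteq> y \<Longrightarrow> \<rho> x \<le> \<rho> y"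
  using rank_less[of x y] by (cases "x = y") (auto simp: lless_iff)

lemma rank_le_n: "x \<in> carrier L \<Longrightarrow> \<rho> x \<le> n"
  using finite_carrier by (auto simp: n_def poset_rank_def)

text \<open>Leads from the extended lattice back to \<open>L\<close>: the cases are the two forms
  \<open>Some \<mu>\<close> and \<open>None\<close> of the join, and its being the least upper bound
  gives both descriptions of the common upper bounds.\<close>

lemma join_cases:
  assumes "\<sigma> \<in> carrier L"
  obtains (proper) \<mu> where "\<sigma> \<in> \<Lambda>\<^sub>\<nu>" "\<mu> \<in> carrier L"
      "\<And>\<pi>. \<pi> \<in> carrier L \<Longrightarrow> \<sigma> \<sqsubseteq> \<pi> \<and> \<nu> \<sqsubseteq> \<pi> \<longleftrightarrow> \<mu> \<sqsubseteq> \<pi>"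
    | (top) "\<sigma> \<notin> \<Lambda>\<^sub>\<nu>" "\<And>\<pi>. \<pi> \<in> carrier L \<Longrightarrow> \<not> (\<sigma> \<sqsubseteq> \<pi> \<and> \<nu> \<sqsubseteq> \<pi>)"
proof -
  interpret T: lattice "add_top L" by (rule lattice_top)
  let ?j = "Some \<sigma> \<squnion>\<^bsub>add_top L\<^esub> Some \<nu>"
  have carr: "Some \<sigma> \<in> carrier (add_top L)" "Some \<nu> \<in> carrier (add_top L)"
    using assms nu_carrier by auto
  have j: "?j \<in> carrier (add_top L)" "Some \<sigma> \<sqsubseteq>\<^bsub>add_top L\<^esub> ?j" "Some \<nu> \<sqsubseteq>\<^bsub>add_top L\<^esub> ?j"
    using T.join_closed[OF carr] T.join_left[OF carr] T.join_right[OF carr] by auto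
  have least: "?j \<sqsubseteq>\<^bsub>add_top L\<^esub> Some \<pi>" if "\<pi> \<in> carrier L" "\<sigma> \<sqsubseteq> \<pi>" "\<nu> \<sqsubseteq> \<pi>" for \<pi>
    using that carr by (intro T.join_le) auto
  show thesis
  proof (cases ?j)
    case None
    have "\<sigma> \<notin> \<Lambda>\<^sub>\<nu>" by (simp add: join_below_top_def None)
    then show thesis using least None by (intro top) auto
  next
    case (Some \<mu>)
    then have \<mu>: "\<mu> \<in> carrier L" "\<sigma> \<sqsubseteq> \<mu>" "\<nu> \<sqsubseteq> \<mu>" using j by auto
    have "\<sigma> \<in> \<Lambda>\<^sub>\<nu>" using assms by (simp add: join_below_top_def Some)
    moreover have "\<sigma> \<sqsubseteq> \<pi> \<and> \<nu> \<sqsubseteq> \<pi> \<longleftrightarrow> \<mu> \<sqsubseteq> \<pi>" if "\<pi> \<in> carrier L" for \<pi>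
      using least[OF that] \<mu> assms nu_carrier that unfolding Some by (auto intro: le_trans)
    ultimately show thesis using \<mu> by (intro proper)
  qed
qed

text \<open>Removes the join from \<open>\<Lambda>\<^sub>\<nu>\<close>, so that down-closure and the
  membership of elements above \<nu> can be read off from the order.\<close>

lemma join_below_top_iff: "\<sigma> \<in> \<Lambda>\<^sub>\<nu> \<longleftrightarrow> \<sigma> \<in> carrier L \<and> (\<exists>\<pi>\<in>carrier L. \<sigma> \<sqsubseteq> \<pi> \<and> \<nu> \<sqsubseteq> \<pi>)"
proof (cases "\<sigma> \<in> carrier L")
  case True
  then show ?thesis by (rule join_cases) (use True in auto)
qed (simp add: join_below_top_def)

lemma join_below_top_carrier: "\<sigma> \<in> \<Lambda>\<^sub>\<nu> \<Longrightarrow> \<sigma> \<in> carrier L"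
  by (simp add: join_below_top_def)

text \<open>In the proper case the sum runs over the interval from the join \<mu> to the adjoined
  top, without that top. The full Eulerian sum is 0, so minus the sign of the top remains, and
  measuring signs from n turns it into 1.\<close>

lemma sum_sign_above:
  assumes \<sigma>: "\<sigma> \<in> carrier L"
  shows "(\<Sum>\<pi>\<in>{\<pi>\<in>carrier L. \<sigma> \<sqsubseteq> \<pi> \<and> \<nu> \<sqsubseteq> \<pi>}. (- 1 :: int) ^ (n - \<rho> \<pi>)) = (if \<sigma> \<in> \<Lambda>\<^sub>\<nu> then 1 else 0)"
  using \<sigma>
proof (cases \<sigma> rule: join_cases)
  case (proper \<mu>)
  let ?U = "{\<pi>\<in>carrier L. \<mu> \<sqsubseteq> \<pi>}"
  have "{x\<in>carrier (add_top L). Some \<mu> \<sqsubseteq>\<^bsub>add_top L\<^esub> x \<and> x \<sqsubseteq>\<^bsub>add_top L\<^esub> None} = insert None (Some ` ?U)"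
    by auto
  then have "(\<Sum>x\<in>insert None (Some ` ?U).
      (- 1 :: int) ^ (add_top_rank L \<rho> x - add_top_rank L \<rho> (Some \<mu>))) = 0"
    using eul[unfolded eulerian_def, rule_format, of "Some \<mu>" None] proper by simp
  then have "(\<Sum>\<pi>\<in>?U. (- 1) ^ (\<rho> \<pi> - \<rho> \<mu>)) + (- 1 :: int) ^ (n + 1 - \<rho> \<mu>) = 0"
    using finite_carrier by (simp add: sum.insert_if sum.reindex add_top_rank_def add.commute flip: n_def)
  then have eul_\<mu>: "(\<Sum>\<pi>\<in>?U. (- 1) ^ (\<rho> \<pi> - \<rho> \<mu>)) = - ((- 1 :: int) ^ (n + 1 - \<rho> \<mu>))"
    by (simp only: eq_neg_iff_add_eq_0)
  \<comment> \<open>The Eulerian relation measures signs from \<mu>, the goal from n. The two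
    exponents add up to n - \<rho>(\<mu>), so multiplying by that sign changes one into the
    other.\<close>
  have "(\<Sum>\<pi>\<in>?U. (- 1 :: int) ^ (n - \<rho> \<pi>)) = (\<Sum>\<pi>\<in>?U. (- 1) ^ (n - \<rho> \<mu>) * (- 1) ^ (\<rho> \<pi> - \<rho> \<mu>))"
  proof (rule sum.cong)
    fix \<pi> assume "\<pi> \<in> ?U"
    then have "\<rho> \<mu> \<le> \<rho> \<pi>" "\<rho> \<pi> \<le> n" using rank_le rank_le_n proper by auto
    then have "n - \<rho> \<mu> = (n - \<rho> \<pi>) + (\<rho> \<pi> - \<rho> \<mu>)" by simp
    then show "(- 1 :: int) ^ (n - \<rho> \<pi>) = (- 1) ^ (n - \<rho> \<mu>) * (- 1) ^ (\<rho> \<pi> - \<rho> \<mu>)"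
      by (simp only: power_add mult.assoc) (simp flip: power_add mult_2)
  qed simp
  also have "\<dots> = (- 1) ^ (n - \<rho> \<mu>) * (- ((- 1) ^ (n + 1 - \<rho> \<mu>)))"
    by (simp only: eul_\<mu> flip: sum_distrib_left)
  \<comment> \<open>The exponents add up to the odd number 2(n - \<rho>(\<mu>)) + 1, and the outer
    minus sign makes the product 1.\<close>
  also have "\<dots> = 1"
    using rank_le_n[of \<mu>] proper by (simp add: Suc_diff_le flip: power_add mult_2)
  finally have "(\<Sum>\<pi>\<in>?U. (- 1 :: int) ^ (n - \<rho> \<pi>)) = 1" .
  moreover have "{\<pi>\<in>carrier L. \<sigma> \<sqsubseteq> \<pi> \<and> \<nu> \<sqsubseteq> \<pi>} = ?U"
    using proper by blast
  ultimately show ?thesis using proper by simp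
next
  case top
  then have "{\<pi>\<in>carrier L. \<sigma> \<sqsubseteq> \<pi> \<and> \<nu> \<sqsubseteq> \<pi>} = {}" by blast
  then show ?thesis using top by (simp only: sum.empty if_False)
qed

section \<open>The poset with the new element\<close>

lemma star_order: "finite_partial_order (add_star L \<nu>)"
proof unfold_locales
  show "finite (carrier (add_star L \<nu>))"
    using finite_carrier by (simp add: join_below_top_def)
  show "x .=\<^bsub>add_star L \<nu>\<^esub> y" if "x \<sqsubseteq>\<^bsub>add_star L \<nu>\<^esub> y" "y \<sqsubseteq>\<^bsub>add_star L \<nu>\<^esub> x"
    "x \<in> carrier (add_star L \<nu>)" "y \<in> carrier (add_star L \<nu>)" for x y
    using that by (cases x; cases y) (auto intro: le_antisym join_below_top_carrier)
  fix x y w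
  assume "x \<sqsubseteq>\<^bsub>add_star L \<nu>\<^esub> y" "y \<sqsubseteq>\<^bsub>add_star L \<nu>\<^esub> w"
    "x \<in> carrier (add_star L \<nu>)" "y \<in> carrier (add_star L \<nu>)" "w \<in> carrier (add_star L \<nu>)"
  \<comment> \<open>The case not inherited from \<open>L\<close> ends in the new element: if
    \<sigma> \<le> \<tau> and \<nu> is not below \<tau>, then \<nu> is not below \<sigma>.\<close>
  then show "x \<sqsubseteq>\<^bsub>add_star L \<nu>\<^esub> w"
    using nu_carrier
    by (cases x; cases y; cases w) (auto intro: le_trans join_below_top_carrier)
qed (auto simp: join_below_top_carrier)

lemma lless_add_star [simp]:
  "\<not> None \<sqsubset>\<^bsub>add_star L \<nu>\<^esub> x"
  "Some \<sigma> \<sqsubset>\<^bsub>add_star L \<nu>\<^esub> None \<longleftrightarrow> \<not> \<nu> \<sqsubseteq> \<sigma>"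
  "Some \<sigma> \<sqsubset>\<^bsub>add_star L \<nu>\<^esub> Some \<tau> \<longleftrightarrow> \<sigma> \<sqsubset> \<tau>"
  by (cases x) (auto simp: finite_partial_order.lless_iff[OF star_order] lless_iff)

lemma bottom_in_join_below_top: "\<bottom> \<in> \<Lambda>\<^sub>\<nu>"
  using nu_carrier by (auto simp: join_below_top_iff)

lemma bottom_add_star: "\<bottom>\<^bsub>add_star L \<nu>\<^esub> = Some \<bottom>"
proof -
  \<comment> \<open>This puts the minimum of \<open>L\<close> below the new element.\<close>
  have "\<not> \<nu> \<sqsubseteq> \<bottom>" using bottom_less_nu nu_carrier le_antisym by (auto simp: lless_iff)
  then show ?thesis
    by (intro finite_partial_order.bottom_eqI[OF star_order])
      (auto simp: least_def bottom_in_join_below_top intro: join_below_top_carrier)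
qed

text \<open>The new element is below nothing, so it occurs in no chain ending in
  \<open>Some \<sigma>\<close>; and \<open>\<Lambda>\<^sub>\<nu>\<close> is down-closed in
  \<open>L\<close>. The restriction \<open>?M\<close> links the two facts.\<close>

lemma chain_sum_add_star_Some:
  assumes "\<sigma> \<in> \<Lambda>\<^sub>\<nu>"
  shows "chain_sum (add_star L \<nu>) (add_star_rank L \<rho>) (Some \<sigma>) = F \<sigma>"
proof -
  let ?M = "L\<lparr>carrier := \<Lambda>\<^sub>\<nu>\<rparr>"
  have sub: "\<Lambda>\<^sub>\<nu> \<subseteq> carrier L" by (auto simp: join_below_top_iff)
  have down: "y \<in> \<Lambda>\<^sub>\<nu>" if "x \<in> \<Lambda>\<^sub>\<nu>" "y \<in> carrier L" "y \<sqsubset> x" for x y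
    using that by (auto simp: join_below_top_iff lless_iff intro: le_trans)
  have "chain_sum (add_star L \<nu>) (add_star_rank L \<rho>) (Some \<sigma>) = chain_sum ?M \<rho> \<sigma>"
    by (rule chain_sum_embedding)
      (use assms sub in \<open>auto simp: bottom_restrict bottom_in_join_below_top bottom_add_star add_star_rank_def\<close>)
  also have "\<dots> = F \<sigma>"
    using sub bottom_in_join_below_top assms down by (rule chain_sum_restrict)
  finally show ?thesis .
qed

text \<open>The first sum collects the chains ending in some \<open>Some \<sigma>\<close>, the
  second those ending in the new element, grouped by the entry before it. The new element has rank n
  and the top n + 1, so the latter end with z^0.\<close>

lemma ab_index_add_star:
  "ab_index (add_star L \<nu>) (add_star_rank L \<rho>) (n + 1) =
    (\<Sum>\<sigma>\<in>\<Lambda>\<^sub>\<nu>. F \<sigma> * z ^ (n - \<rho> \<sigma>)) + (\<Sum>\<sigma>\<in>{\<sigma>\<in>\<Lambda>\<^sub>\<nu>. \<not> \<nu> \<sqsubseteq> \<sigma>}. F \<sigma> * z ^ (n - \<rho> \<sigma> - 1) * ab_b)"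
proof -
  interpret S: finite_partial_order "add_star L \<nu>" by (rule star_order)
  let ?S = "add_star L \<nu>" and ?r = "add_star_rank L \<rho>"
  have fin: "finite \<Lambda>\<^sub>\<nu>" using finite_carrier by (simp add: join_below_top_def)
  have rank: "?r None = n" "?r (Some \<sigma>) = \<rho> \<sigma>" for \<sigma>
    by (simp_all add: add_star_rank_def n_def)
  have below: "{\<sigma>\<in>carrier ?S. \<sigma> \<sqsubset>\<^bsub>?S\<^esub> None} = Some ` {\<sigma>\<in>\<Lambda>\<^sub>\<nu>. \<not> \<nu> \<sqsubseteq> \<sigma>}" by auto
  have star: "chain_sum ?S ?r None = (\<Sum>\<sigma>\<in>{\<sigma>\<in>\<Lambda>\<^sub>\<nu>. \<not> \<nu> \<sqsubseteq> \<sigma>}. F \<sigma> * z ^ (n - \<rho> \<sigma> - 1) * ab_b)"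
    using S.chain_sum_rec[of None ?r] unfolding below
    by (simp add: bottom_add_star sum.reindex rank sum_distrib_right chain_sum_add_star_Some)
  show ?thesis
    unfolding S.ab_index_eq_chain_sum
    using fin by (simp add: sum.insert_if sum.reindex rank chain_sum_add_star_Some star add.commute)
qed

section \<open>Products with \<alpha> and the exchange of sums\<close>

abbreviation "G \<sigma> \<equiv> F \<sigma> * (z ^ (n - \<rho> \<sigma>) + z ^ (n - \<rho> \<sigma> - 1) * ab_b)"

text \<open>In the expansion of \<alpha> the terms z^(k+1) and z^k b turn \<Psi> into the sum of the
  G \<sigma> with \<sigma> < \<pi>. The terms b z^k and b z^(k-1) b turn \<Psi> b into F \<pi> and
  supply G \<pi> together with the correction.\<close>

lemma ab_index_below_mult_alpha:
  assumes \<pi>: "\<pi> \<in> carrier L" "\<nu> \<sqsubseteq> \<pi>"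
  shows "ab_index (below L \<pi>) \<rho> (\<rho> \<pi>) * alpha (n + 1 - \<rho> \<pi>) =
    of_int ((- 1) ^ (n - \<rho> \<pi>)) * (\<Sum>\<sigma>\<in>{\<sigma>\<in>carrier L. \<sigma> \<sqsubseteq> \<pi>}. G \<sigma>)
      - F \<pi> * z ^ (n - \<rho> \<pi> - 1) * ab_b"
proof -
  let ?\<Psi> = "ab_index (below L \<pi>) \<rho> (\<rho> \<pi>)" and ?B = "{\<sigma>\<in>carrier L. \<sigma> \<sqsubset> \<pi>}"
  define k where "k = n - \<rho> \<pi>"
  have bot: "\<bottom> \<sqsubset> \<pi>"
    using \<pi> bottom_less_nu nu_carrier by (auto simp: lless_iff intro: le_trans le_antisym)
  have k: "n = \<rho> \<pi> + k" using rank_le_n \<pi> by (simp add: k_def)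
  have \<Psi>b: "?\<Psi> * ab_b * x = F \<pi> * x" for x
    using chain_sum_eq_ab_index_below[OF \<pi>(1) bot] by simp
  \<comment> \<open>Appending z^j only lengthens the last factor of every chain, as if the top had
    rank \<rho>(\<pi>) + j. The strict rank inequality makes the truncated exponents add up.\<close>
  have \<Psi>z: "?\<Psi> * z ^ j = (\<Sum>\<sigma>\<in>?B. F \<sigma> * z ^ (\<rho> \<pi> + j - \<rho> \<sigma> - 1))" for j
    unfolding ab_index_below[OF \<pi>(1) bot] sum_distrib_right mult.assoc power_add[symmetric]
  proof (intro sum.cong HOL.refl)
    fix \<sigma> assume "\<sigma> \<in> ?B"
    then have "\<rho> \<sigma> < \<rho> \<pi>" using rank_less \<pi> by auto
    then have "\<rho> \<pi> - \<rho> \<sigma> - 1 + j = \<rho> \<pi> + j - \<rho> \<sigma> - 1" by simp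
    then show "F \<sigma> * z ^ (\<rho> \<pi> - \<rho> \<sigma> - 1 + j) = F \<sigma> * z ^ (\<rho> \<pi> + j - \<rho> \<sigma> - 1)" by simp
  qed
  have sum_B: "?\<Psi> * (z ^ Suc k + z ^ k * ab_b) = (\<Sum>\<sigma>\<in>?B. G \<sigma>)"
    unfolding distrib_left mult.assoc[symmetric] \<Psi>z
    by (simp add: k sum_distrib_right sum.distrib)
  have "{\<sigma>\<in>carrier L. \<sigma> \<sqsubseteq> \<pi>} = insert \<pi> ?B"
    using \<pi> by (auto simp: lless_iff)
  then have "(\<Sum>\<sigma>\<in>{\<sigma>\<in>carrier L. \<sigma> \<sqsubseteq> \<pi>}. G \<sigma>) = G \<pi> + ?\<Psi> * (z ^ Suc k + z ^ k * ab_b)"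
    unfolding sum_B using finite_carrier by (simp add: lless_iff)
  then have sum_G: "(\<Sum>\<sigma>\<in>{\<sigma>\<in>carrier L. \<sigma> \<sqsubseteq> \<pi>}. G \<sigma>) =
      F \<pi> * z ^ k + F \<pi> * z ^ (k - 1) * ab_b + ?\<Psi> * z ^ Suc k + ?\<Psi> * z ^ k * ab_b"
    by (simp only: k_def[symmetric] distrib_left mult.assoc[symmetric] add.assoc[symmetric])
  \<comment> \<open>For even k the term with z^(k-1) in G \<pi> cancels the correction, so its
    truncated exponent at k = 0 is harmless. For odd k the two have the same sign and match the
    doubled term of \<alpha>.\<close>
  have "?\<Psi> * alpha (Suc k) =
      of_int ((- 1) ^ k) * (\<Sum>\<sigma>\<in>{\<sigma>\<in>carrier L. \<sigma> \<sqsubseteq> \<pi>}. G \<sigma>) - F \<pi> * z ^ (k - 1) * ab_b"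
  proof (cases "even k")
    case True
    then show ?thesis
      unfolding sum_G
      by (simp add: alpha_Suc_even distrib_left \<Psi>b del: power_Suc flip: mult.assoc)
  next
    case False
    then show ?thesis
      unfolding sum_G
      by (simp add: alpha_Suc_odd distrib_left right_diff_distrib \<Psi>b del: power_Suc flip: mult.assoc)
  qed
  then show ?thesis using k by simp
qed

lemma sum_ab_index_below_mult_alpha:
  "(\<Sum>\<pi>\<in>{\<pi>\<in>carrier L. \<nu> \<sqsubseteq> \<pi>}. ab_index (below L \<pi>) \<rho> (\<rho> \<pi>) * alpha (n + 1 - \<rho> \<pi>)) =
    (\<Sum>\<sigma>\<in>\<Lambda>\<^sub>\<nu>. G \<sigma>) - (\<Sum>\<pi>\<in>{\<pi>\<in>carrier L. \<nu> \<sqsubseteq> \<pi>}. F \<pi> * z ^ (n - \<rho> \<pi> - 1) * ab_b)"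
proof -
  let ?U = "{\<pi>\<in>carrier L. \<nu> \<sqsubseteq> \<pi>}" and ?s = "\<lambda>\<pi>. (- 1 :: int) ^ (n - \<rho> \<pi>)"
  have "(\<Sum>\<pi>\<in>?U. of_int (?s \<pi>) * (\<Sum>\<sigma>\<in>{\<sigma>\<in>carrier L. \<sigma> \<sqsubseteq> \<pi>}. G \<sigma>)) =
      (\<Sum>\<pi>\<in>?U. \<Sum>\<sigma>\<in>{\<sigma>\<in>carrier L. \<sigma> \<sqsubseteq> \<pi>}. of_int (?s \<pi>) * G \<sigma>)"
    by (simp only: sum_distrib_left)
  \<comment> \<open>With \<pi> as the inner variable G \<sigma> is a common factor, so the signs
    alone are added and \<open>sum_sign_above\<close> applies.\<close>
  also have "\<dots> = (\<Sum>\<sigma>\<in>carrier L. \<Sum>\<pi>\<in>{\<pi>\<in>?U. \<sigma> \<sqsubseteq> \<pi>}. of_int (?s \<pi>) * G \<sigma>)"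
    using finite_carrier by (intro sum.swap_restrict) auto
  also have "\<dots> = (\<Sum>\<sigma>\<in>carrier L. of_int (if \<sigma> \<in> \<Lambda>\<^sub>\<nu> then 1 else 0) * G \<sigma>)"
  proof (rule sum.cong[OF HOL.refl])
    fix \<sigma> assume \<sigma>: "\<sigma> \<in> carrier L"
    have "{\<pi>\<in>?U. \<sigma> \<sqsubseteq> \<pi>} = {\<pi>\<in>carrier L. \<sigma> \<sqsubseteq> \<pi> \<and> \<nu> \<sqsubseteq> \<pi>}" by auto
    then show "(\<Sum>\<pi>\<in>{\<pi>\<in>?U. \<sigma> \<sqsubseteq> \<pi>}. of_int (?s \<pi>) * G \<sigma>) = of_int (if \<sigma> \<in> \<Lambda>\<^sub>\<nu> then 1 else 0) * G \<sigma>"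
      by (simp only: sum_sign_above[OF \<sigma>] flip: sum_distrib_right of_int_sum)
  qed
  also have "\<dots> = (\<Sum>\<sigma>\<in>carrier L. if \<sigma> \<in> \<Lambda>\<^sub>\<nu> then G \<sigma> else 0)"
    by (intro sum.cong) auto
  also have "\<dots> = (\<Sum>\<sigma>\<in>\<Lambda>\<^sub>\<nu>. G \<sigma>)"
    using finite_carrier by (intro sum.mono_neutral_cong_right) (auto simp: join_below_top_iff)
  finally show ?thesis
    by (subst sum.cong[OF HOL.refl ab_index_below_mult_alpha]) (auto simp only: sum_subtractf)
qed

text \<open>G \<sigma> is what \<sigma> contributes to the left side when it lies below the new
  element. The elements above \<nu> do not lie below it but do belong to
  \<open>\<Lambda>\<^sub>\<nu>\<close>; their surplus is the sum subtracted in
  \<open>sum_ab_index_below_mult_alpha\<close>.\<close>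

lemma ab_index_add_star_eq_sum:
  "ab_index (add_star L \<nu>) (add_star_rank L \<rho>) (n + 1) =
    (\<Sum>\<pi>\<in>{\<pi>\<in>carrier L. \<nu> \<sqsubseteq> \<pi>}. ab_index (below L \<pi>) \<rho> (\<rho> \<pi>) * alpha (n + 1 - \<rho> \<pi>))"
proof -
  let ?U = "{\<pi>\<in>carrier L. \<nu> \<sqsubseteq> \<pi>}" and ?h = "\<lambda>\<sigma>. F \<sigma> * z ^ (n - \<rho> \<sigma> - 1) * ab_b"
  have "\<pi> \<in> \<Lambda>\<^sub>\<nu>" if "\<pi> \<in> ?U" for \<pi>
    using that by (auto simp: join_below_top_iff intro!: bexI[of _ \<pi>])
  then have "?U \<subseteq> \<Lambda>\<^sub>\<nu>" by (rule subsetI)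
  moreover have "{\<sigma>\<in>\<Lambda>\<^sub>\<nu>. \<not> \<nu> \<sqsubseteq> \<sigma>} = \<Lambda>\<^sub>\<nu> - ?U" by (auto intro: join_below_top_carrier)
  moreover have "finite \<Lambda>\<^sub>\<nu>" using finite_carrier by (simp add: join_below_top_def)
  ultimately have "sum ?h {\<sigma>\<in>\<Lambda>\<^sub>\<nu>. \<not> \<nu> \<sqsubseteq> \<sigma>} = sum ?h \<Lambda>\<^sub>\<nu> - sum ?h ?U"
    by (simp only: sum_diff)
  then show ?thesis
    unfolding ab_index_add_star sum_ab_index_below_mult_alpha
    by (simp add: distrib_left sum.distrib mult.assoc)
qed

end

theorem theorem3p5:
  fixes L :: "'a gorder" and \<rho> :: "'a \<Rightarrow> nat" and n :: nat and \<nu> :: 'a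
  assumes "graded_poset L \<rho>"
    and "n = poset_rank L \<rho>"
    and "lattice (add_top L)"
    and "eulerian L \<rho>"
    and "\<nu> \<in> carrier L"
    and "\<bottom>\<^bsub>L\<^esub> \<sqsubset>\<^bsub>L\<^esub> \<nu>"
  shows "ab_index (add_star L \<nu>) (add_star_rank L \<rho>) (n + 1) =
    (\<Sum>\<pi>\<in>{\<pi>\<in>carrier L. \<nu> \<sqsubseteq>\<^bsub>L\<^esub> \<pi>}. ab_index (below L \<pi>) \<rho> (\<rho> \<pi>) * alpha (n + 1 - \<rho> \<pi>))"
proof -
  interpret graded_eulerian_lattice L \<rho> n \<nu>
    by (rule graded_eulerian_lattice.intro) (fact assms)+
  show ?thesis by (rule ab_index_add_star_eq_sum)
qed

end
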